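(* Consider a system of three robots in the plane with initial positions $R=(r_0,r_1,r_2)$, in general position, such that $d(r_0,r_1)\le d(r_1,r_2)\le d(r_2,r_0)$, and a triangular pattern $P=(p_0,p_1,p_2)$, scaled to have perimeter $1$, such that $d(p_0,p_1)\le d(p_1,p_2)\le d(p_2,p_0)$. Let $Q=(q_0,q_1,q_2)$ be the positions the robots move to after running the following algorithm: for each $i\in\{0,1,2\}$ (indices modulo $3$), let $t_i$ be the point such that $\angle t_i r_{i+1} r_{i-1}=\angle p_i p_{i+1}p_{i-1}$ and $\angle r_{i+1}r_{i-1}t_i=\angle p_{i+1}p_{i-1}p_i$, that is, the point for which the triangle $(r_{i+1},r_{i-1},t_i)$ is rigidly similar to $(p_{i+1},p_{i-1},p_i)$; robot $i$ moves from $r_i$ a distance $r=d(r_i,t_i)\,d(p_{i+1},p_{i-1})$ toward $t_i$, ending at $q_i$. Then $Q$ is an optimal formation: $Q$ is similar to $P$, and for every sequence $F=(f_0,f_1,f_2)$ similar to $P$, $$\max_{0\le i\le 2} d(r_i,q_i)\ \le\ \max_{0\le i\le 2} d(r_i,f_i).$$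
   Context: $d(\cdot,\cdot)$ is Euclidean distance. A pattern is a sequence of distinct points in the plane; a triangular pattern is the sequence of the three vertices of a triangle. Two sequences $P,Q$ of points of equal length are similar if some translation, rotation, uniform scaling, and/or reflection of some permutation of $P$ equals $Q$ entry by entry. They are rigidly similar if some translation, rotation, and/or uniform scaling of $P$ (no reflection and no permutation) equals $Q$ entry by entry. The robots are to form $P$, i.e. reach positions similar to $P$, and a formation is optimal if it minimizes the maximum distance traveled by any robot. General position is assumed so that symmetric initial configurations of the robots are excluded.
   Formalization: If R and P have opposite orientations, t_i is defined by rigid similarity to the mirror image of P instead of P; the literal claim fails then, e.g. when R is the mirror image of a scalene P (F=R costs 0, yet the robots move). *)

theory Defs
  imports "HOL-Analysis.Analysis" "HOL-Library.Multiset"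
begin

text \<open>
  The plane is \<^typ>\<open>complex\<close>, with \<^const>\<open>dist\<close> as Euclidean distance. Finite sequences of points
  are lists. Triples whose indices are read modulo 3 are functions on the type \<open>3\<close>, whose
  elements are 0, 1, 2 and whose arithmetic is modulo 3.
\<close>

definition seq3 :: "(3 \<Rightarrow> complex) \<Rightarrow> complex list" where
  "seq3 x = [x 0, x 1, x 2]"

text \<open>Scaling by \<open>c\<close>, rotation by \<open>\<theta>\<close>, then translation by \<open>b\<close>.\<close>

definition rigidly_similar :: "complex list \<Rightarrow> complex list \<Rightarrow> bool" where
  "rigidly_similar P Q \<longleftrightarrow>
     (\<exists>c \<theta> b. c > 0 \<and> Q = map (\<lambda>z. of_real c * cis \<theta> * z + b) P)"

text \<open>
  Up to rotation and translation, \<^const>\<open>cnj\<close> (reflection in the real axis) is the only reflection.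
  \<open>P'\<close> is a permutation of \<open>P\<close>.
\<close>

definition similar :: "complex list \<Rightarrow> complex list \<Rightarrow> bool" where
  "similar P Q \<longleftrightarrow>
     (\<exists>P'. mset P' = mset P \<and> (rigidly_similar P' Q \<or> rigidly_similar (map cnj P') Q))"

text \<open>The unsigned angle at the vertex \<open>b\<close>, in \<open>[0, \<pi>]\<close>.\<close>

definition angle :: "complex \<Rightarrow> complex \<Rightarrow> complex \<Rightarrow> real" where
  "angle a b c = arccos (((a - b) \<bullet> (c - b)) / (norm (a - b) * norm (c - b)))"

text \<open>
  Twice the signed area of the triangle, positive iff its vertices are listed counterclockwise.
\<close>

definition orientation :: "(3 \<Rightarrow> complex) \<Rightarrow> real" where
  "orientation x = Im (cnj (x 1 - x 0) * (x 2 - x 0))"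

text \<open>
  Formations may be reflected, so a pattern and its mirror image describe the same task. A point
  \<open>t\<close> with prescribed unsigned angles at two given points is determined only up to reflection in
  the line through them; the intended one belongs to the copy of the pattern that has the
  orientation of the robots. This is \<open>p\<close> itself if \<open>r\<close> and \<open>p\<close> are equally oriented. Using the
  copy of the opposite orientation does not give an optimal formation: for robots at the mirror
  image of a scalene pattern it would prescribe a positive distance although none is needed.
\<close>

definition oriented_like :: "(3 \<Rightarrow> complex) \<Rightarrow> (3 \<Rightarrow> complex) \<Rightarrow> 3 \<Rightarrow> complex" where
  "oriented_like r p = (if orientation r * orientation p > 0 then p else cnj \<circ> p)"

text \<open>
  The endpoint of a move of length \<open>d\<close> from \<open>a\<close> towards \<open>b\<close>; for \<open>a = b\<close> it is \<open>a\<close>.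
\<close>

definition move_toward :: "complex \<Rightarrow> real \<Rightarrow> complex \<Rightarrow> complex" where
  "move_toward a d b = a + d *\<^sub>R sgn (b - a)"

definition optimal_formation ::
    "(3 \<Rightarrow> complex) \<Rightarrow> (3 \<Rightarrow> complex) \<Rightarrow> (3 \<Rightarrow> complex) \<Rightarrow> bool" where
  "optimal_formation r p q \<longleftrightarrow>
     similar (seq3 p) (seq3 q) \<and>
     (\<forall>f. similar (seq3 p) (seq3 f) \<longrightarrow> (MAX i. dist (r i) (q i)) \<le> (MAX i. dist (r i) (f i)))"

end

theory Submission
  imports Defs
begin

text \<open>
  Write \<open>e\<^sub>i = p\<^sub>i\<^sub>+\<^sub>1 - p\<^sub>i\<^sub>-\<^sub>1\<close>. A triple \<open>f\<close> is \<open>a p + b\<close> for some complex \<open>a\<close>, \<open>b\<close> iff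
  \<open>\<Sum> e\<^sub>i f\<^sub>i = 0\<close>. Put \<open>D = \<Sum> e\<^sub>i r\<^sub>i\<close>. Since \<open>\<Sum> \<bar>e\<^sub>i\<bar> = 1\<close>, every such \<open>f\<close> satisfies
  \<open>\<bar>D\<bar> = \<bar>\<Sum> e\<^sub>i (r\<^sub>i - f\<^sub>i)\<bar> \<le> max \<bar>r\<^sub>i - f\<^sub>i\<bar>\<close>. The point \<open>t\<^sub>i\<close> satisfies \<open>e\<^sub>i (r\<^sub>i - t\<^sub>i) = D\<close>, so that
  each robot moves by exactly \<open>\<bar>D\<bar>\<close> and \<open>\<Sum> e\<^sub>i q\<^sub>i = D - D \<Sum> \<bar>e\<^sub>i\<bar> = 0\<close>; if all \<open>q\<^sub>i\<close> coincided, \<open>r\<close> and \<open>p\<close>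
  would be oppositely oriented. Other labellings and reflections of \<open>p\<close> do no better: with \<open>R\<^sub>i\<close>,
  \<open>P\<^sub>i\<close> the squared side lengths and \<open>O\<close> the orientation,
  \<open>\<bar>D\<bar>\<^sup>2 = (\<Sum> R\<^sub>i) (\<Sum> P\<^sub>i) / 2 - \<Sum> R\<^sub>i P\<^sub>i - 2 O(r) O(p)\<close>, which by the rearrangement inequality is
  smallest when the sides are sorted alike and the orientations agree.
\<close>

lemma three_eq_0 [simp]: "(3::3) = 0"
  using bit1.of_nat_eq[of 3, where 'a = "num1"] by simp

lemma minus_one_three [simp]: "(- 1::3) = 2"
  using three_eq_0 by (simp add: minus_equation_iff[of 1] eq_neg_iff_add_eq_0)

lemma UNIV_three: "(UNIV :: 3 set) = {0, 1, 2}"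
  unfolding UNIV_3 by auto

lemma all_three: "(\<forall>i::3. Q i) \<longleftrightarrow> Q 0 \<and> Q 1 \<and> Q 2"
  by (metis (full_types) UNIV_I UNIV_three empty_iff insert_iff)

lemma sum_three: "(\<Sum>i\<in>UNIV. x i) = x 0 + x 1 + x (2::3)"
  unfolding UNIV_three by (simp add: add.assoc)

text \<open>Indexed by the opposite vertex and directed so that the three edges sum to 0.\<close>

definition edge :: "(3 \<Rightarrow> complex) \<Rightarrow> 3 \<Rightarrow> complex" where
  "edge p i = p (i + 1) - p (i - 1)"

definition misfit :: "(3 \<Rightarrow> complex) \<Rightarrow> (3 \<Rightarrow> complex) \<Rightarrow> complex" where
  "misfit p r = (\<Sum>i\<in>UNIV. edge p i * r i)"

lemma edge_simps [simp]:
  "edge p 0 = p 1 - p 2" "edge p 1 = p 2 - p 0" "edge p 2 = p 0 - p 1"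
  by (simp_all add: edge_def)

lemma misfit_three:
  "misfit p r = (p 1 - p 2) * r 0 + (p 2 - p 0) * r 1 + (p 0 - p 1) * r 2"
  by (simp add: misfit_def sum_three)

lemma Im_mult_of_real: "Im (of_real c * z) = c * Im z"
  by simp

lemma orientation_eq_0_imp_collinear:
  assumes "orientation x = 0"
  shows "collinear {x 0, x 1, x 2}"
proof -
  define u v where "u = x 1 - x 0" and "v = x 2 - x 0"
  have *: "Re u * Im v = Im u * Re v"
    using assms by (simp add: orientation_def u_def v_def algebra_simps)
  have "v = (Re (cnj u * v) / (norm u)\<^sup>2) *\<^sub>R u" if "u \<noteq> 0"
  proof -
    \<comment> \<open>By \<open>*\<close> the number \<open>cnj u * v\<close> is real, and
      \<open>u\<close> times it is \<open>(norm u)\<^sup>2 *\<^sub>R v\<close>.\<close>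
    have "(norm u)\<^sup>2 *\<^sub>R v = Re (cnj u * v) *\<^sub>R u"
      using * by (auto simp: complex_eq_iff cmod_power2) algebra+
    then show ?thesis
      using that by (simp add: eq_vector_fraction_iff)
  qed
  then have "collinear {0, u, v}"
    unfolding collinear_lemma by blast
  \<comment> \<open>\<open>collinear_3\<close> takes differences from the middle point, so
    \<open>x 0\<close> is listed there.\<close>
  then have "collinear {x 1, x 0, x 2}"
    unfolding u_def v_def by (subst collinear_3) (simp_all add: NO_MATCH_def)
  then show ?thesis
    by (simp add: insert_commute)
qed

lemma rigidly_similarE:
  assumes "rigidly_similar P Q"
  obtains k b where "Q = map (\<lambda>z. k * z + b) P"
  using assms unfolding rigidly_similar_def by metis

lemma rigidly_similar_imp_misfit_eq_0:
  assumes "rigidly_similar (seq3 p) (seq3 f)"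
  shows "misfit p f = 0"
proof -
  obtain k b where "seq3 f = map (\<lambda>z. k * z + b) (seq3 p)"
    using rigidly_similarE[OF assms] .
  then have "f 0 = k * p 0 + b" "f 1 = k * p 1 + b" "f 2 = k * p 2 + b"
    by (simp_all add: seq3_def)
  then show ?thesis
    by (simp add: misfit_three algebra_simps)
qed

text \<open>The first two points determine the factor \<open>k\<close>, and the vanishing misfit
  forces the same factor on the third. The condition on \<open>q\<close> rules out
  \<open>k = 0\<close>, since a rigid similarity has positive scale.\<close>

lemma rigidly_similarI:
  assumes "misfit p q = 0" "p 0 \<noteq> p 1" "q 0 \<noteq> q 1 \<or> q 0 \<noteq> q 2"
  shows "rigidly_similar (seq3 p) (seq3 q)"
proof -
  define k b where "k = (q 1 - q 0) / (p 1 - p 0)" and "b = q 0 - k * p 0"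
  have "q 1 - q 0 = k * (p 1 - p 0)"
    using assms(2) by (simp add: k_def)
  then have q1: "q 1 = k * p 1 + b"
    by (simp add: b_def algebra_simps)
  have "(p 1 - p 0) * (q 2 - q 0) = (p 2 - p 0) * (q 1 - q 0)"
    using assms(1) unfolding misfit_three by algebra
  also have "\<dots> = (p 1 - p 0) * (k * (p 2 - p 0))"
    using assms(2) by (simp add: k_def)
  finally have "q 2 - q 0 = k * (p 2 - p 0)"
    using assms(2) by simp
  then have q2: "q 2 = k * p 2 + b"
    by (simp add: b_def algebra_simps)
  have "k \<noteq> 0"
    using assms(3) q1 q2 b_def by auto
  moreover have "k = of_real (norm k) * cis (Arg k)"
    by (metis rcis_cmod_Arg rcis_def)
  ultimately show ?thesis
    using q1 q2 b_def unfolding rigidly_similar_def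
    by (intro exI[of _ "norm k"] exI[of _ "Arg k"] exI[of _ b]) (simp add: seq3_def)
qed

lemma norm_misfit_le:
  assumes "misfit p f = 0" "(\<Sum>i\<in>UNIV. norm (edge p i)) = 1"
  shows "norm (misfit p r) \<le> (MAX i. dist (r i) (f i))"
proof -
  let ?M = "MAX i. dist (r i) (f i)"
  have "misfit p r = (\<Sum>i\<in>UNIV. edge p i * (r i - f i))"
    using assms(1) by (simp add: misfit_def sum_subtractf algebra_simps)
  also have "norm \<dots> \<le> (\<Sum>i\<in>UNIV. norm (edge p i * (r i - f i)))"
    by (rule norm_sum)
  also have "\<dots> \<le> (\<Sum>i\<in>UNIV. norm (edge p i) * ?M)"
    by (intro sum_mono) (simp add: norm_mult mult_left_mono flip: dist_norm)
  also have "\<dots> = ?M"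
    using assms(2) by (simp flip: sum_distrib_right)
  finally show ?thesis .
qed

text \<open>Differences from vertex 0 reduce this to a polynomial identity in the coordinates of
  four vectors. The right-hand side sees the pattern only through its labelled side lengths and its
  orientation, which makes relabelled and reflected patterns comparable.\<close>

lemma norm_misfit_sq:
  "(norm (misfit p r))\<^sup>2 =
     (\<Sum>i\<in>UNIV. (norm (edge r i))\<^sup>2) * (\<Sum>i\<in>UNIV. (norm (edge p i))\<^sup>2) / 2
     - (\<Sum>i\<in>UNIV. (norm (edge r i))\<^sup>2 * (norm (edge p i))\<^sup>2) - 2 * orientation r * orientation p"
proof -
  define a b where "a = r 1 - r 0" and "b = r 2 - r 0"
  define c d where "c = p 1 - p 0" and "d = p 2 - p 0"
  have "misfit p r = d * a - c * b"
    by (simp add: misfit_three a_def b_def c_def d_def algebra_simps)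
  moreover have "orientation r = Im (cnj a * b)" "orientation p = Im (cnj c * d)"
    by (simp_all add: orientation_def a_def b_def c_def d_def)
  moreover have "norm (edge r 0) = norm (a - b)" "norm (edge r 1) = norm b"
    "norm (edge r 2) = norm a" "norm (edge p 0) = norm (c - d)" "norm (edge p 1) = norm d"
    "norm (edge p 2) = norm c"
    by (simp_all add: a_def b_def c_def d_def norm_minus_commute)
  moreover have "(norm (d * a - c * b))\<^sup>2 =
      ((norm (a - b))\<^sup>2 + (norm b)\<^sup>2 + (norm a)\<^sup>2) * ((norm (c - d))\<^sup>2 + (norm d)\<^sup>2 + (norm c)\<^sup>2) / 2
      - ((norm (a - b))\<^sup>2 * (norm (c - d))\<^sup>2 + (norm b)\<^sup>2 * (norm d)\<^sup>2 + (norm a)\<^sup>2 * (norm c)\<^sup>2)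
      - 2 * Im (cnj a * b) * Im (cnj c * d)"
    unfolding cmod_power2 by (simp add: field_simps power2_eq_square)
  ultimately show ?thesis
    unfolding sum_three by (simp del: edge_simps)
qed

text \<open>For each of the six orders the difference of the two sides is a sum of some of the four
  nonnegative products below.\<close>

lemma rearrangement_three:
  fixes a b c x y z :: real
  assumes "a \<le> b" "b \<le> c" "x \<le> y" "y \<le> z" "mset [x', y', z'] = mset [x, y, z]"
  shows "a * x' + b * y' + c * z' \<le> a * x + b * y + c * z"
proof -
  have "(b - a) * (y - x) \<ge> 0" "(b - a) * (z - y) \<ge> 0" "(c - b) * (y - x) \<ge> 0"
    "(c - b) * (z - y) \<ge> 0"
    using assms by simp_all
  moreover have "[x', y', z'] \<in> {[x, y, z], [x, z, y], [y, x, z], [y, z, x], [z, x, y], [z, y, x]}"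
    using assms(5) by (auto simp: add_eq_conv_ex add_mset_eq_single)
  ultimately show ?thesis
    by (auto simp: algebra_simps)
qed

text \<open>This is the algorithm for a pattern already oriented like the robots;
  \<open>same\<close> keeps the robots from all meeting in one point.\<close>

lemma formation_by_equal_moves:
  assumes same: "orientation r * orientation p > 0"
    and perimeter: "(\<Sum>i\<in>UNIV. norm (edge p i)) = 1"
    and sim: "\<And>i. rigidly_similar [p (i + 1), p (i - 1), p i] [r (i + 1), r (i - 1), t i]"
    and q: "\<And>i. q i = move_toward (r i) (dist (r i) (t i) * norm (edge p i)) (t i)"
  shows "rigidly_similar (seq3 p) (seq3 q)" "(MAX i. dist (r i) (q i)) \<le> norm (misfit p r)"
proof -
  define D where "D = misfit p r"
  define s where "s i = sgn (edge p i)" for i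
  have "p 0 \<noteq> p 1" "p 1 \<noteq> p 2" "p 2 \<noteq> p 0"
    using same by (auto simp: orientation_def algebra_simps)
  then have edge_nz: "edge p i \<noteq> 0" for i
    using all_three[of "\<lambda>i. edge p i \<noteq> 0"] by simp
  \<comment> \<open>Replacing \<open>r i\<close> by \<open>t i\<close> turns \<open>r\<close> into
    an image of \<open>p\<close> under \<open>\<lambda>z. k * z + b\<close>, whose misfit is 0; only
    the term of index \<open>i\<close> changes.\<close>
  have tD: "edge p i * (t i - r i) = - D" for i
  proof -
    obtain k b where "[r (i + 1), r (i - 1), t i] =
        map (\<lambda>z. k * z + b) [p (i + 1), p (i - 1), p i]"
      using rigidly_similarE[OF sim[of i]] .
    then have k: "r (i + 1) = k * p (i + 1) + b" "r (i - 1) = k * p (i - 1) + b"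
      "t i = k * p i + b"
      by simp_all
    have "i \<in> {0, 1, 2}"
      using UNIV_three by blast
    then show ?thesis
      using k by (auto simp: D_def misfit_three algebra_simps)
  qed
  have move: "q i = r i - D * cnj (s i)" for i
  proof -
    have "dist (r i) (t i) * norm (edge p i) = norm D"
      using arg_cong[OF tD[of i], of norm]
      by (simp add: norm_mult dist_norm norm_minus_commute mult.commute)
    moreover have "s i * sgn (t i - r i) = - sgn D"
      using arg_cong[OF tD[of i], of sgn] by (simp add: s_def sgn_mult sgn_minus)
    ultimately have "s i * (q i - r i) = norm D *\<^sub>R - sgn D"
      unfolding q move_toward_def by simp
    \<comment> \<open>If \<open>D = 0\<close> then \<open>sgn D = 0\<close>, and the robot stays in
      place.\<close>
    also have "\<dots> = - D"
      by (cases "D = 0") (simp_all add: sgn_div_norm)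
    finally have sD: "s i * (q i - r i) = - D" .
    \<comment> \<open>As \<open>s i\<close> has norm 1, \<open>cnj (s i)\<close> is its
      inverse.\<close>
    have "q i - r i = (cnj (s i) * s i) * (q i - r i)"
      using edge_nz[of i]
      by (simp add: s_def norm_sgn mult.commute complex_norm_square[symmetric])
    also have "\<dots> = cnj (s i) * - D"
      unfolding mult.assoc sD ..
    finally show ?thesis
      by (simp add: algebra_simps)
  qed
  have "dist (r i) (q i) \<le> norm D" for i
    using edge_nz[of i] by (simp add: move dist_norm norm_mult s_def norm_sgn)
  then show "(MAX i. dist (r i) (q i)) \<le> norm (misfit p r)"
    unfolding D_def by simp
  have es: "edge p i * cnj (s i) = norm (edge p i)" for i
    using edge_nz[of i]
    by (simp add: s_def sgn_div_norm scaleR_conv_of_real complex_norm_square[symmetric]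
        power2_eq_square field_simps)
  have "misfit p q = D - D * (\<Sum>i\<in>UNIV. edge p i * cnj (s i))"
    by (simp add: misfit_def move D_def sum_subtractf sum_distrib_left algebra_simps)
  also have "\<dots> = D - D * of_real (\<Sum>i\<in>UNIV. norm (edge p i))"
    by (simp add: es)
  finally have "misfit p q = 0"
    by (simp add: perimeter)
  \<comment> \<open>If all \<open>q i\<close> coincided, \<open>r\<close> would be a translate of
    the triangle \<open>D * cnj (s i)\<close>. The unit edge directions \<open>s i\<close> form a
    triangle oriented like \<open>p\<close>, so conjugation would orient \<open>r\<close> oppositely
    to \<open>p\<close>, or \<open>D = 0\<close> would collapse it.\<close>
  moreover have "q 0 \<noteq> q 1 \<or> q 0 \<noteq> q 2"
  proof (rule ccontr)
    assume "\<not> ?thesis"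
    then have "r 1 - r 0 = D * cnj (s 1 - s 0)" "r 2 - r 0 = D * cnj (s 2 - s 0)"
      by (simp_all add: move algebra_simps)
    then have "cnj (r 1 - r 0) * (r 2 - r 0) =
        of_real ((norm D)\<^sup>2) * ((s 1 - s 0) * cnj (s 2 - s 0))"
      by (simp add: complex_norm_square[of D] mult_ac del: of_real_power)
    then have "orientation r = (norm D)\<^sup>2 * Im ((s 1 - s 0) * cnj (s 2 - s 0))"
      unfolding orientation_def by (simp only: Im_mult_of_real)
    also have "Im ((s 1 - s 0) * cnj (s 2 - s 0)) =
        - (Im (cnj (s 0) * s 1) + Im (cnj (s 1) * s 2) + Im (cnj (s 2) * s 0))"
      by (simp add: algebra_simps)
    also have "\<dots> = - (orientation p * ((1 / (norm (edge p 0) * norm (edge p 1)))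
        + 1 / (norm (edge p 1) * norm (edge p 2)) + 1 / (norm (edge p 2) * norm (edge p 0))))"
    proof -
      have *: "Im (cnj (s i) * s j) = Im (cnj (edge p i) * edge p j) / (norm (edge p i) * norm (edge p j))"
        for i j :: 3
        by (simp add: s_def sgn_div_norm divide_inverse algebra_simps)
      \<comment> \<open>Cyclically consecutive edges span the same signed area because the edges sum
        to 0.\<close>
      have "Im (cnj (edge p 0) * edge p 1) = orientation p"
        "Im (cnj (edge p 1) * edge p 2) = orientation p"
        "Im (cnj (edge p 2) * edge p 0) = orientation p"
        by (simp_all add: orientation_def algebra_simps)
      then show ?thesis
        unfolding * by (simp add: algebra_simps)
    qed
    finally have "orientation r * orientation p =
      - ((norm D)\<^sup>2 * (orientation p)\<^sup>2 * ((1 / (norm (edge p 0) * norm (edge p 1)))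
        + 1 / (norm (edge p 1) * norm (edge p 2)) + 1 / (norm (edge p 2) * norm (edge p 0))))"
      by (simp add: power2_eq_square)
    also have "\<dots> \<le> 0"
      by (simp del: edge_simps)
    finally show False
      using same by simp
  qed
  ultimately show "rigidly_similar (seq3 p) (seq3 q)"
    using \<open>p 0 \<noteq> p 1\<close> by (intro rigidly_similarI)
qed

text \<open>Permutation and reflection are absorbed into a new triangle \<open>p'\<close>, leaving a
  rigid similarity. The side lengths survive as a multiset and the orientation up to sign, which is
  all that the comparison by \<open>norm_misfit_sq\<close> needs.\<close>

lemma similar_seq3E:
  assumes "similar (seq3 p) (seq3 f)"
  obtains p' where "rigidly_similar (seq3 p') (seq3 f)"
    "mset [norm (edge p' 2), norm (edge p' 0), norm (edge p' 1)] =
     mset [norm (edge p 2), norm (edge p 0), norm (edge p 1)]"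
    "\<bar>orientation p'\<bar> = \<bar>orientation p\<bar>"
proof -
  obtain P where P: "mset P = mset (seq3 p)"
    "rigidly_similar P (seq3 f) \<or> rigidly_similar (map cnj P) (seq3 f)"
    using assms unfolding similar_def by blast
  from P(1) have "length P = 3"
    by (metis mset_eq_length seq3_def length_Cons list.size(3) numeral_3_eq_3)
  then obtain x y z where xyz: "P = [x, y, z]"
    by (auto simp: numeral_3_eq_3 length_Suc_conv)
  define p1 where "p1 i = (if i = 0 then x else if i = 1 then y else z)" for i :: 3
  have p1: "p1 0 = x" "p1 1 = y" "p1 2 = z"
    by (simp_all add: p1_def)
  have perm: "[x, y, z] \<in> {[p 0, p 1, p 2], [p 0, p 2, p 1], [p 1, p 0, p 2], [p 1, p 2, p 0],
      [p 2, p 0, p 1], [p 2, p 1, p 0]}"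
    using P(1) by (auto simp: xyz seq3_def add_eq_conv_ex add_mset_eq_single)
  have sides: "mset [norm (edge p1 2), norm (edge p1 0), norm (edge p1 1)] =
     mset [norm (edge p 2), norm (edge p 0), norm (edge p 1)]"
    using perm by (auto simp: p1 norm_minus_commute add_mset_commute)
  have orient: "\<bar>orientation p1\<bar> = \<bar>orientation p\<bar>"
    using perm by (auto simp: orientation_def p1 algebra_simps abs_if)
  show thesis
    using P(2)
  proof
    assume "rigidly_similar P (seq3 f)"
    then show thesis
      using that[of p1] sides orient by (simp add: seq3_def p1 xyz)
  next
    assume "rigidly_similar (map cnj P) (seq3 f)"
    moreover have "norm (edge (cnj \<circ> p1) i) = norm (edge p1 i)" for i
      by (simp add: edge_def flip: complex_cnj_diff)
    moreover have "orientation (cnj \<circ> p1) = - orientation p1"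
      by (simp add: orientation_def algebra_simps)
    ultimately show thesis
      using that[of "cnj \<circ> p1"] sides orient by (simp add: seq3_def p1 xyz del: edge_simps)
  qed
qed

theorem corollary9:
  fixes r p t q :: "3 \<Rightarrow> complex"
  assumes "\<not> collinear {r 0, r 1, r 2}"
    and "dist (r 0) (r 1) \<le> dist (r 1) (r 2)" and "dist (r 1) (r 2) \<le> dist (r 2) (r 0)"
    and "\<not> collinear {p 0, p 1, p 2}"
    and "dist (p 0) (p 1) + dist (p 1) (p 2) + dist (p 2) (p 0) = 1"
    and "dist (p 0) (p 1) \<le> dist (p 1) (p 2)" and "dist (p 1) (p 2) \<le> dist (p 2) (p 0)"
    and "\<And>i. angle (t i) (r (i + 1)) (r (i - 1)) = angle (p i) (p (i + 1)) (p (i - 1))"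
    and "\<And>i. angle (r (i + 1)) (r (i - 1)) (t i) = angle (p (i + 1)) (p (i - 1)) (p i)"
    and "\<And>i. rigidly_similar
            [oriented_like r p (i + 1), oriented_like r p (i - 1), oriented_like r p i]
            [r (i + 1), r (i - 1), t i]"
    and "\<And>i. q i = move_toward (r i) (dist (r i) (t i) * dist (p (i + 1)) (p (i - 1))) (t i)"
  shows "optimal_formation r p q"
proof -
  define w where "w = oriented_like r p"
  have conj_orientation: "orientation (cnj \<circ> p) = - orientation p"
    by (simp add: orientation_def algebra_simps)
  have "orientation r \<noteq> 0" "orientation p \<noteq> 0"
    using assms(1,4) orientation_eq_0_imp_collinear by blast+
  then have same: "orientation r * orientation w > 0"
    unfolding w_def oriented_like_def by (auto simp: conj_orientation not_less less_le)
  have abs_w: "\<bar>orientation w\<bar> = \<bar>orientation p\<bar>"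
    by (simp add: w_def oriented_like_def conj_orientation)
  have norm_w: "norm (edge w i) = norm (edge p i)" for i
    by (simp add: w_def oriented_like_def edge_def flip: complex_cnj_diff)
  have perimeter: "(\<Sum>i\<in>UNIV. norm (edge p i)) = 1"
    using assms(5) by (simp add: sum_three dist_norm)
  have q: "q i = move_toward (r i) (dist (r i) (t i) * norm (edge w i)) (t i)" for i
    unfolding norm_w assms(11) by (simp add: edge_def dist_norm)
  note formation = formation_by_equal_moves[OF same _ assms(10)[folded w_def] q,
      unfolded norm_w, OF perimeter]
  have "similar (seq3 p) (seq3 q)"
  proof -
    \<comment> \<open>The trivial permutation suffices: the mirrored case is the reflection disjunct
      of \<open>similar\<close>.\<close>
    have "seq3 w = seq3 p \<or> seq3 w = map cnj (seq3 p)"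
      by (simp add: w_def oriented_like_def seq3_def)
    then show ?thesis
      using formation(1) unfolding similar_def by metis
  qed
  moreover have "(MAX i. dist (r i) (q i)) \<le> (MAX i. dist (r i) (f i))"
    if f: "similar (seq3 p) (seq3 f)" for f
  proof -
    obtain p' where p': "rigidly_similar (seq3 p') (seq3 f)"
      and sides: "mset [norm (edge p' 2), norm (edge p' 0), norm (edge p' 1)] =
         mset [norm (edge p 2), norm (edge p 0), norm (edge p 1)]"
      and orient: "\<bar>orientation p'\<bar> = \<bar>orientation p\<bar>"
      using similar_seq3E[OF f] .
    \<comment> \<open>Symmetric sums do not see the labelling. Squares serve
      \<open>norm_misfit_sq\<close>, the lengths themselves the perimeter.\<close>
    have invariant: "(\<Sum>i\<in>UNIV. h (norm (edge p' i))) = (\<Sum>i\<in>UNIV. h (norm (edge p i)))"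
      for h :: "real \<Rightarrow> real"
      using arg_cong[OF sides, of "\<lambda>M. sum_mset (image_mset h M)"]
      by (simp add: sum_three add_ac del: edge_simps)
    \<comment> \<open>Both products have the same absolute value, and the one with \<open>w\<close>
      is positive.\<close>
    have "orientation r * orientation p' \<le> orientation r * orientation w"
      using same abs_w orient by (metis abs_ge_self abs_mult abs_of_pos)
    moreover have "(\<Sum>i\<in>UNIV. (norm (edge r i))\<^sup>2 * (norm (edge p' i))\<^sup>2)
        \<le> (\<Sum>i\<in>UNIV. (norm (edge r i))\<^sup>2 * (norm (edge p i))\<^sup>2)"
    proof -
      \<comment> \<open>The order 2, 0, 1 lists the sides of \<open>r\<close> and of
        \<open>p\<close> from shortest to longest, as \<open>rearrangement_three\<close>
        requires.\<close>
      have "mset [(norm (edge p' 2))\<^sup>2, (norm (edge p' 0))\<^sup>2, (norm (edge p' 1))\<^sup>2] =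
         mset [(norm (edge p 2))\<^sup>2, (norm (edge p 0))\<^sup>2, (norm (edge p 1))\<^sup>2]"
        using arg_cong[OF sides, of "image_mset (\<lambda>x. x\<^sup>2)"] by (simp del: edge_simps)
      then have "(norm (edge r 2))\<^sup>2 * (norm (edge p' 2))\<^sup>2 + (norm (edge r 0))\<^sup>2 * (norm (edge p' 0))\<^sup>2
          + (norm (edge r 1))\<^sup>2 * (norm (edge p' 1))\<^sup>2
        \<le> (norm (edge r 2))\<^sup>2 * (norm (edge p 2))\<^sup>2 + (norm (edge r 0))\<^sup>2 * (norm (edge p 0))\<^sup>2
          + (norm (edge r 1))\<^sup>2 * (norm (edge p 1))\<^sup>2"
        using assms(2,3,6,7)
        by (intro rearrangement_three) (simp_all add: dist_norm)
      then show ?thesis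
        by (simp add: sum_three add_ac del: edge_simps)
    qed
    \<comment> \<open>The leading terms agree by \<open>invariant\<close>, and both subtracted terms
      are at least as large for \<open>w\<close>.\<close>
    ultimately have "(norm (misfit w r))\<^sup>2 \<le> (norm (misfit p' r))\<^sup>2"
      unfolding norm_misfit_sq norm_w invariant[of "\<lambda>x. x\<^sup>2"] by linarith
    then have "norm (misfit w r) \<le> norm (misfit p' r)"
      by simp
    also have "\<dots> \<le> (MAX i. dist (r i) (f i))"
      using rigidly_similar_imp_misfit_eq_0[OF p'] invariant[of "\<lambda>x. x"] perimeter
      by (intro norm_misfit_le) auto
    finally show ?thesis
      using formation(2) by linarith
  qed
  ultimately show ?thesis
    unfolding optimal_formation_def by blast
qed

end
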